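(* Let $K$ be a finite abstract simplicial complex with weight function $w$ and let $0\le i\le \dim K$. The spectrum of $\mathcal{L}_i^{up}(K,w)$ is bounded from above by: (i) $i+2$, if $\mathcal{L}_i^{up}(K,w)=\Delta_i^{up}(K)$ is the normalized combinatorial Laplace operator; (ii) $(i+2)\max_{F\in S_i(K)}\deg F$, if $\mathcal{L}_i^{up}(K,w)=L_i^{up}(K)$, i.e. $w\equiv 1$; (iii) $(i+2)\,\dfrac{\max_{F\in S_i(K)}\deg F}{\min_{F\in S_i(K)}w(F)}$, for every other weight function $w$.
   Context: A finite abstract simplicial complex $K$ is a collection of subsets (faces) of a finite vertex set, closed under inclusion, containing the empty face (dimension $-1$). $S_i(K)$ is the set of $i$-faces; facets are faces maximal under inclusion. $C^i(K,\mathbb{R})$ is the space of real functions on oriented $i$-faces that change sign when the orientation is reversed. The coboundary $\delta_i:C^i\to C^{i+1}$ is $(\delta_i f)([v_0,\dots,v_{i+1}])=\sum_{j}(-1)^j f([v_0,\dots,\hat v_j,\dots,v_{i+1}])$. A weight function assigns a positive real $w(F)$ to each face $F$ and defines inner products $(f,g)_{C^i}=\sum_{F\in S_i(K)}w(F)f([F])g([F])$. With $\delta_i^*$ the adjoint, $\mathcal{L}_i^{up}(K,w)=\delta_i^*\delta_i$ on $C^i(K,\mathbb{R})$. The degree of an $i$-face $F$ is $\deg F=\sum_{\bar F\in S_{i+1}(K),\,F\subset\bar F}w(\bar F)$. The normalized combinatorial Laplacian $\Delta_i^{up}(K)$ is $\mathcal{L}_i^{up}(K,w)$ for the weight function with $w(F)=1$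 for every facet $F$ and $w(F)=\deg F$ for every face $F$ that is not a facet. *)

theory Defs
  imports Complex_Main "HOL-Combinatorics.Permutations"
begin

definition abstract_simplicial_complex :: "'a set set \<Rightarrow> bool" where
  "abstract_simplicial_complex K \<longleftrightarrow>
     (\<exists>V. finite V \<and> K \<subseteq> Pow V) \<and> {} \<in> K \<and> (\<forall>F\<in>K. \<forall>G. G \<subseteq> F \<longrightarrow> G \<in> K)"

text \<open>Dimensions are integers, so that the empty face has dimension \<open>-1\<close>.\<close>

definition face_dim :: "'a set \<Rightarrow> int" where
  "face_dim F = int (card F) - 1"

definition complex_dim :: "'a set set \<Rightarrow> int" where
  "complex_dim K = Max (face_dim ` K)"

definition faces :: "'a set set \<Rightarrow> int \<Rightarrow> 'a set set" where
  "faces K i = {F \<in> K. face_dim F = i}"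

definition facet :: "'a set set \<Rightarrow> 'a set \<Rightarrow> bool" where
  "facet K F \<longleftrightarrow> F \<in> K \<and> (\<forall>G\<in>K. F \<subseteq> G \<longrightarrow> G = F)"

text \<open>Only the values of a weight function on the faces of \<open>K\<close> matter.\<close>

definition weight_function :: "'a set set \<Rightarrow> ('a set \<Rightarrow> real) \<Rightarrow> bool" where
  "weight_function K w \<longleftrightarrow> (\<forall>F\<in>K. w F > 0)"

definition degree :: "'a set set \<Rightarrow> ('a set \<Rightarrow> real) \<Rightarrow> 'a set \<Rightarrow> real" where
  "degree K w F = (\<Sum>G | G \<in> faces K (face_dim F + 1) \<and> F \<subset> G. w G)"

text \<open>
  An oriented face is an ordering \<open>[v\<^sub>0, \<dots>, v\<^sub>i]\<close> of its vertices up to even permutations.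
  A function on oriented faces that changes sign under reversal of the orientation is thus the
  same thing as an alternating function on orderings. Orderings are distinct lists, and cochains
  are set to zero on all other lists, so that equality of cochains is equality of functions.
\<close>

definition ordered_faces :: "'a set set \<Rightarrow> int \<Rightarrow> 'a list set" where
  "ordered_faces K i = {vs. distinct vs \<and> set vs \<in> faces K i}"

definition cochains :: "'a set set \<Rightarrow> int \<Rightarrow> ('a list \<Rightarrow> real) set" where
  "cochains K i =
     {f. (\<forall>vs. vs \<notin> ordered_faces K i \<longrightarrow> f vs = 0) \<and>
         (\<forall>vs\<in>ordered_faces K i. \<forall>p. p permutes {..<length vs} \<longrightarrow>
             f (permute_list p vs) = of_int (sign p) * f vs)}"

definition coboundary :: "'a set set \<Rightarrow> int \<Rightarrow> ('a list \<Rightarrow> real) \<Rightarrow> ('a list \<Rightarrow> real)" where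
  "coboundary K i f =
     (\<lambda>vs. if vs \<in> ordered_faces K (i + 1)
           then \<Sum>j<length vs. (-1) ^ j * f (take j vs @ drop (Suc j) vs) else 0)"

text \<open>
  The inner product needs some orientation of every face; for alternating functions the product
  of the two values does not depend on the choice.
\<close>

definition orientation :: "'a set \<Rightarrow> 'a list" where
  "orientation F = (SOME vs. distinct vs \<and> set vs = F)"

definition cochain_inner ::
    "'a set set \<Rightarrow> ('a set \<Rightarrow> real) \<Rightarrow> int \<Rightarrow> ('a list \<Rightarrow> real) \<Rightarrow> ('a list \<Rightarrow> real) \<Rightarrow> real" where
  "cochain_inner K w i f g = (\<Sum>F\<in>faces K i. w F * f (orientation F) * g (orientation F))"

text \<open>Existence and uniqueness of the adjoint are shown in \<open>coboundary_adjoint\<close> below.\<close>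

definition coboundary_adj ::
    "'a set set \<Rightarrow> ('a set \<Rightarrow> real) \<Rightarrow> int \<Rightarrow> ('a list \<Rightarrow> real) \<Rightarrow> ('a list \<Rightarrow> real)" where
  "coboundary_adj K w i h =
     (THE g. g \<in> cochains K i \<and>
        (\<forall>f\<in>cochains K i.
           cochain_inner K w (i + 1) (coboundary K i f) h = cochain_inner K w i f g))"

definition up_laplacian ::
    "'a set set \<Rightarrow> ('a set \<Rightarrow> real) \<Rightarrow> int \<Rightarrow> ('a list \<Rightarrow> real) \<Rightarrow> ('a list \<Rightarrow> real)" where
  "up_laplacian K w i f = coboundary_adj K w i (coboundary K i f)"

text \<open>
  The set of eigenvalues of an operator on a space of real functions (multiplicities play no
  role for upper bounds).
\<close>

definition spectrum_on :: "('b \<Rightarrow> real) set \<Rightarrow> (('b \<Rightarrow> real) \<Rightarrow> ('b \<Rightarrow> real)) \<Rightarrow> real set" where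
  "spectrum_on V T = {c. \<exists>f\<in>V. f \<noteq> (\<lambda>_. 0) \<and> T f = (\<lambda>x. c * f x)}"

lemma degree_cong [fundef_cong]:
  assumes "K = K'" "F = F'" "\<And>G. G \<in> K' \<Longrightarrow> F' \<subset> G \<Longrightarrow> w G = w' G"
  shows "degree K w F = degree K' w' F'"
  using assms by (auto simp: degree_def faces_def intro!: sum.cong)

text \<open>
  The weight with value 1 on facets and value \<open>deg F\<close> on every other face is determined by
  recursion from the facets downwards. The conditions \<open>finite K\<close> and \<open>F \<in> K\<close> make the function
  total.
\<close>

function normalized_weight :: "'a set set \<Rightarrow> 'a set \<Rightarrow> real" where
  "normalized_weight K F =
     (if finite K \<and> F \<in> K \<and> \<not> facet K F then degree K (\<lambda>G. normalized_weight K G) F else 1)"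
  by pat_completeness auto
termination
proof (relation "measure (\<lambda>(K, F). card {H \<in> K. F \<subset> H})")
  fix K :: "'a set set" and F G
  assume a: "finite K \<and> F \<in> K \<and> \<not> facet K F" "G \<in> K" "F \<subset> G"
  then have "{H \<in> K. G \<subset> H} \<subset> {H \<in> K. F \<subset> H}" by blast
  then have "card {H \<in> K. G \<subset> H} < card {H \<in> K. F \<subset> H}"
    using a by (intro psubset_card_mono) auto
  then show "((K, G), (K, F)) \<in> measure (\<lambda>(K, F). card {H \<in> K. F \<subset> H})" by simp
qed simp

declare normalized_weight.simps [simp del]

definition normalized_up_laplacian ::
    "'a set set \<Rightarrow> int \<Rightarrow> ('a list \<Rightarrow> real) \<Rightarrow> ('a list \<Rightarrow> real)" where
  "normalized_up_laplacian K i = up_laplacian K (normalized_weight K) i"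


subsection \<open>The definitions are meaningful\<close>

lemma finite_complex: "abstract_simplicial_complex K \<Longrightarrow> finite K"
  unfolding abstract_simplicial_complex_def by (meson finite_Pow_iff finite_subset)

lemma finite_face: "abstract_simplicial_complex K \<Longrightarrow> F \<in> K \<Longrightarrow> finite F"
  unfolding abstract_simplicial_complex_def by (meson PowD finite_subset subsetD)

lemma finite_faces: "abstract_simplicial_complex K \<Longrightarrow> finite (faces K i)"
  by (simp add: faces_def finite_complex)

lemma normalized_weight_eq:
  assumes "abstract_simplicial_complex K" "F \<in> K"
  shows "normalized_weight K F =
    (if facet K F then 1 else degree K (normalized_weight K) F)"
  using assms finite_complex[OF assms(1)] by (subst normalized_weight.simps) auto

lemma normalized_weight_unique:
  assumes K: "abstract_simplicial_complex K"
    and w: "\<And>F. F \<in> K \<Longrightarrow> w F = (if facet K F then 1 else degree K w F)"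
    and "F \<in> K"
  shows "w F = normalized_weight K F"
  using \<open>F \<in> K\<close>
proof (induction "card {H \<in> K. F \<subset> H}" arbitrary: F rule: less_induct)
  case less
  have "w G = normalized_weight K G" if "G \<in> K" "F \<subset> G" for G
  proof (rule less.hyps)
    have "{H \<in> K. G \<subset> H} \<subset> {H \<in> K. F \<subset> H}" using that by blast
    then show "card {H \<in> K. G \<subset> H} < card {H \<in> K. F \<subset> H}"
      using finite_complex[OF K] by (intro psubset_card_mono) auto
  qed fact
  then have "degree K w F = degree K (normalized_weight K) F"
    by (intro degree_cong) auto
  then show ?case
    using w[OF less.prems] normalized_weight_eq[OF K less.prems] by simp
qed

lemma weight_function_normalized_weight:
  assumes K: "abstract_simplicial_complex K"
  shows "weight_function K (normalized_weight K)"
proof -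
  have "normalized_weight K F > 0" if "F \<in> K" for F
    using that
  proof (induction "card {H \<in> K. F \<subset> H}" arbitrary: F rule: less_induct)
    case less
    have pos: "normalized_weight K G > 0" if "G \<in> K" "F \<subset> G" for G
    proof (rule less.hyps)
      have "{H \<in> K. G \<subset> H} \<subset> {H \<in> K. F \<subset> H}" using that by blast
      then show "card {H \<in> K. G \<subset> H} < card {H \<in> K. F \<subset> H}"
        using finite_complex[OF K] by (intro psubset_card_mono) auto
    qed fact
    show ?case
    proof (cases "facet K F")
      case True
      then show ?thesis using normalized_weight_eq[OF K less.prems] by simp
    next
      case False
      then obtain H x where H: "H \<in> K" "F \<subseteq> H" "x \<in> H" "x \<notin> F"
        using less.prems by (auto simp: facet_def)
      then have "insert x F \<in> K"
        using K by (auto simp: abstract_simplicial_complex_def)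
      then have "insert x F \<in> {G. G \<in> faces K (face_dim F + 1) \<and> F \<subset> G}"
        using H finite_face[OF K less.prems] by (auto simp: faces_def face_dim_def)
      moreover have "finite {G. G \<in> faces K (face_dim F + 1) \<and> F \<subset> G}"
        using finite_faces[OF K] by simp
      ultimately have "degree K (normalized_weight K) F > 0"
        unfolding degree_def using pos by (intro sum_pos) (auto simp: faces_def)
      then show ?thesis using False normalized_weight_eq[OF K less.prems] by simp
    qed
  qed
  then show ?thesis by (simp add: weight_function_def)
qed

lemma orientation:
  assumes "finite F" shows "distinct (orientation F)" "set (orientation F) = F"
proof -
  have "\<exists>vs. distinct vs \<and> set vs = F" using finite_distinct_list[OF assms] by blast
  from someI_ex[OF this] show "distinct (orientation F)" "set (orientation F) = F"
    by (simp_all add: orientation_def)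
qed

lemma orientation_in:
  assumes "abstract_simplicial_complex K" "F \<in> faces K i"
  shows "orientation F \<in> ordered_faces K i" "set (orientation F) = F"
  using assms orientation[of F] finite_face[of K F] by (auto simp: ordered_faces_def faces_def)

lemma ordering_permute:
  assumes "distinct us" "distinct vs" "set us = set vs"
  obtains p where "p permutes {..<length us}" "permute_list p us = vs"
proof -
  have "mset vs = mset us" using assms by (simp add: set_eq_iff_mset_eq_distinct)
  then show ?thesis using that mset_eq_permutation by metis
qed

lemma permute_list_inj:
  assumes "distinct us" "p permutes {..<length us}" "q permutes {..<length us}"
    "permute_list p us = permute_list q us"
  shows "p = q"
proof
  fix n show "p n = q n"
  proof (cases "n < length us")
    case True
    then have "us ! p n = us ! q n"
      using assms permute_list_nth by metis
    moreover have "p n < length us" "q n < length us"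
      using True assms permutes_in_image by fastforce+
    ultimately show ?thesis using assms(1) by (simp add: nth_eq_iff_index_eq)
  next
    case False
    then show ?thesis using assms by (simp add: permutes_def)
  qed
qed

lemma cochain_eqI:
  assumes K: "abstract_simplicial_complex K" and f: "f \<in> cochains K i" and g: "g \<in> cochains K i"
    and eq: "\<And>F. F \<in> faces K i \<Longrightarrow> f (orientation F) = g (orientation F)"
  shows "f = g"
proof
  fix vs
  show "f vs = g vs"
  proof (cases "vs \<in> ordered_faces K i")
    case False
    then show ?thesis using f g by (simp add: cochains_def)
  next
    case True
    define F where "F = set vs"
    have F: "F \<in> faces K i" and d: "distinct vs" using True by (auto simp: F_def ordered_faces_def)
    note o = orientation_in[OF K F]
    obtain p where p: "p permutes {..<length (orientation F)}" "permute_list p (orientation F) = vs"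
      using ordering_permute[of "orientation F" vs] o d F_def by (auto simp: ordered_faces_def)
    then show ?thesis using f g o eq[OF F] by (auto simp: cochains_def)
  qed
qed

text \<open>The cochain dual to a face with its chosen orientation.\<close>

definition face_cochain :: "'a set \<Rightarrow> 'a list \<Rightarrow> real" where
  "face_cochain F vs =
     (if distinct vs \<and> set vs = F
      then of_int (sign (THE p. p permutes {..<length (orientation F)} \<and>
                                permute_list p (orientation F) = vs))
      else 0)"

lemma face_cochain_permute:
  assumes "finite F" "p permutes {..<length (orientation F)}"
  shows "face_cochain F (permute_list p (orientation F)) = of_int (sign p)"
proof -
  let ?o = "orientation F"
  have "(THE q. q permutes {..<length ?o} \<and> permute_list q ?o = permute_list p ?o) = p"
    using assms orientation[of F] permute_list_inj[of ?o] by (intro the_equality) auto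
  then show ?thesis
    using assms orientation[of F] by (simp add: face_cochain_def)
qed

lemma face_cochain_orientation:
  assumes "finite F" "finite G"
  shows "face_cochain F (orientation G) = (if F = G then 1 else 0)"
proof (cases "F = G")
  case True
  then show ?thesis
    using face_cochain_permute[OF assms(1), of id] by (simp add: permutes_id)
next
  case False
  then show ?thesis using orientation[OF assms(2)] by (auto simp: face_cochain_def)
qed

lemma face_cochain_in:
  assumes K: "abstract_simplicial_complex K" and F: "F \<in> faces K i"
  shows "face_cochain F \<in> cochains K i"
proof -
  have fin: "finite F" using F finite_face[OF K] by (auto simp: faces_def)
  have "face_cochain F (permute_list p vs) = of_int (sign p) * face_cochain F vs"
    if vs: "vs \<in> ordered_faces K i" and p: "p permutes {..<length vs}" for vs p
  proof (cases "set vs = F")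
    case False
    then show ?thesis using p by (simp add: face_cochain_def)
  next
    case True
    have d: "distinct vs" using vs by (simp add: ordered_faces_def)
    obtain q where q: "q permutes {..<length (orientation F)}" "permute_list q (orientation F) = vs"
      using ordering_permute[of "orientation F" vs] orientation[OF fin] d True by metis
    have p': "p permutes {..<length (orientation F)}" using p q(2) by auto
    have "permute_list p vs = permute_list (q \<circ> p) (orientation F)"
      using permute_list_compose[OF p', of q] q(2) by simp
    moreover have "(q \<circ> p) permutes {..<length (orientation F)}"
      using p' q(1) by (rule permutes_compose)
    moreover have "sign (q \<circ> p) = sign q * sign p"
      using p' q(1) by (intro sign_compose) (auto simp: permutation_permutes)
    ultimately show ?thesis
      using face_cochain_permute[OF fin] q by (metis mult.commute of_int_mult)
  qed
  moreover have "face_cochain F vs = 0" if "vs \<notin> ordered_faces K i" for vs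
    using that F by (auto simp: face_cochain_def ordered_faces_def)
  ultimately show ?thesis by (auto simp: cochains_def)
qed

lemma cochains_sum:
  assumes "\<And>F. F \<in> A \<Longrightarrow> e F \<in> cochains K i"
  shows "(\<lambda>vs. \<Sum>F\<in>A. c F * e F vs) \<in> cochains K i"
  using assms by (auto simp: cochains_def sum_distrib_left mult_ac intro!: sum.cong sum.neutral)

lemma cochain_expand:
  assumes K: "abstract_simplicial_complex K" and f: "f \<in> cochains K i"
  shows "f = (\<lambda>vs. \<Sum>F\<in>faces K i. f (orientation F) * face_cochain F vs)"
proof (rule cochain_eqI[OF K f])
  show "(\<lambda>vs. \<Sum>F\<in>faces K i. f (orientation F) * face_cochain F vs) \<in> cochains K i"
    by (intro cochains_sum face_cochain_in[OF K])
next
  fix G assume G: "G \<in> faces K i"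
  have "(\<Sum>F\<in>faces K i. f (orientation F) * face_cochain F (orientation G)) =
        (\<Sum>F\<in>faces K i. if F = G then f (orientation F) else 0)"
    using G finite_face[OF K] by (intro sum.cong) (auto simp: face_cochain_orientation faces_def)
  then show "f (orientation G) =
      (\<Sum>F\<in>faces K i. f (orientation F) * face_cochain F (orientation G))"
    using G finite_faces[OF K] by simp
qed

lemma coboundary_sum:
  "coboundary K i (\<lambda>vs. \<Sum>F\<in>A. c F * e F vs) = (\<lambda>vs. \<Sum>F\<in>A. c F * coboundary K i (e F) vs)"
proof
  fix vs
  have "(\<Sum>j<length vs. (-1) ^ j * (\<Sum>F\<in>A. c F * e F (take j vs @ drop (Suc j) vs))) =
        (\<Sum>F\<in>A. c F * (\<Sum>j<length vs. (-1) ^ j * e F (take j vs @ drop (Suc j) vs)))"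
    unfolding sum_distrib_left by (subst sum.swap) (simp add: mult_ac)
  then show "coboundary K i (\<lambda>vs. \<Sum>F\<in>A. c F * e F vs) vs =
      (\<Sum>F\<in>A. c F * coboundary K i (e F) vs)"
    by (simp add: coboundary_def)
qed

lemma cochain_inner_sum:
  "cochain_inner K w i (\<lambda>vs. \<Sum>F\<in>A. c F * e F vs) h = (\<Sum>F\<in>A. c F * cochain_inner K w i (e F) h)"
  unfolding cochain_inner_def sum_distrib_left sum_distrib_right
  by (subst sum.swap) (simp add: mult_ac)

lemma coboundary_adjoint_ex1:
  assumes K: "abstract_simplicial_complex K" and w: "weight_function K w"
  shows "\<exists>!g. g \<in> cochains K i \<and>
    (\<forall>f\<in>cochains K i. cochain_inner K w (i + 1) (coboundary K i f) h = cochain_inner K w i f g)"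
proof (rule ex_ex1I)
  define b where "b F = cochain_inner K w (i + 1) (coboundary K i (face_cochain F)) h" for F
  define g where "g = (\<lambda>vs. \<Sum>F\<in>faces K i. (b F / w F) * face_cochain F vs)"
  have g: "g \<in> cochains K i"
    unfolding g_def by (intro cochains_sum face_cochain_in[OF K])
  have val: "w G * g (orientation G) = b G" if G: "G \<in> faces K i" for G
  proof -
    have "g (orientation G) = (\<Sum>F\<in>faces K i. if F = G then b F / w F else 0)"
      unfolding g_def using G finite_face[OF K]
      by (intro sum.cong) (auto simp: face_cochain_orientation faces_def)
    also have "\<dots> = b G / w G" using G finite_faces[OF K] by simp
    finally show ?thesis using G w by (auto simp: weight_function_def faces_def)
  qed
  have "cochain_inner K w (i + 1) (coboundary K i f) h = cochain_inner K w i f g"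
    if f: "f \<in> cochains K i" for f
  proof -
    have "cochain_inner K w (i + 1) (coboundary K i f) h = (\<Sum>F\<in>faces K i. f (orientation F) * b F)"
      unfolding b_def
      by (subst cochain_expand[OF K f]) (simp add: coboundary_sum cochain_inner_sum)
    also have "\<dots> = cochain_inner K w i f g"
      unfolding cochain_inner_def using val by (intro sum.cong) (auto simp: mult_ac simp flip: val)
    finally show ?thesis .
  qed
  with g show "\<exists>g. g \<in> cochains K i \<and>
    (\<forall>f\<in>cochains K i. cochain_inner K w (i + 1) (coboundary K i f) h = cochain_inner K w i f g)"
    by blast
next
  fix g g'
  assume g: "g \<in> cochains K i \<and>
      (\<forall>f\<in>cochains K i. cochain_inner K w (i + 1) (coboundary K i f) h = cochain_inner K w i f g)"
    and g': "g' \<in> cochains K i \<and>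
      (\<forall>f\<in>cochains K i. cochain_inner K w (i + 1) (coboundary K i f) h = cochain_inner K w i f g')"
  show "g = g'"
  proof (rule cochain_eqI[OF K])
    fix G assume G: "G \<in> faces K i"
    have inner: "cochain_inner K w i (face_cochain G) k = w G * k (orientation G)" for k
    proof -
      have "cochain_inner K w i (face_cochain G) k =
          (\<Sum>F\<in>faces K i. if F = G then w F * k (orientation F) else 0)"
        unfolding cochain_inner_def using G finite_face[OF K]
        by (intro sum.cong) (auto simp: face_cochain_orientation faces_def)
      then show ?thesis using G finite_faces[OF K] by simp
    qed
    have "cochain_inner K w i (face_cochain G) g = cochain_inner K w i (face_cochain G) g'"
      using g g' face_cochain_in[OF K G] by metis
    then show "g (orientation G) = g' (orientation G)"
      using G w unfolding inner by (auto simp: weight_function_def faces_def)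
  qed (use g g' in auto)
qed

lemma coboundary_adjoint:
  assumes "abstract_simplicial_complex K" "weight_function K w"
  shows "coboundary_adj K w i h \<in> cochains K i"
    and "f \<in> cochains K i \<Longrightarrow>
      cochain_inner K w (i + 1) (coboundary K i f) h = cochain_inner K w i f (coboundary_adj K w i h)"
  using theI'[OF coboundary_adjoint_ex1[OF assms, of i h]] unfolding coboundary_adj_def by auto

end

theory Submission
  imports Defs "HOL-Analysis.Convex"
begin

text \<open>
  The Rayleigh quotient of \<open>f\<close> is \<open>(\<delta> f, \<delta> f) / (f, f)\<close>. On an \<open>(i + 1)\<close>-face \<open>G\<close> the value of
  \<open>\<delta> f\<close> is a signed sum of \<open>i + 2\<close> values of \<open>f\<close>, so by the Cauchy-Schwarz inequality its square is at
  most \<open>i + 2\<close> times the sum of \<open>f(F)\<^sup>2\<close> over the \<open>i\<close>-faces \<open>F \<subset> G\<close>. Exchanging the two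
  summations bounds \<open>(\<delta> f, \<delta> f)\<close> by \<open>(i + 2) \<Sum>F. deg F f(F)\<^sup>2\<close>. Hence \<open>(i + 2) M\<close> bounds the
  spectrum whenever \<open>deg F \<le> M w(F)\<close> for all \<open>i\<close>-faces \<open>F\<close>, and each of the three bounds is of
  this form.
\<close>

lemma degree_nonneg:
  assumes "weight_function K w"
  shows "0 \<le> degree K w F"
  unfolding degree_def using assms
  by (intro sum_nonneg) (auto simp: faces_def weight_function_def less_imp_le)

text \<open>Two orderings of the same face differ by a permutation, whose sign squares to 1. Squared
  values therefore belong to the face itself, so the orientations induced by deleting a vertex can
  be exchanged for the chosen ones.\<close>

lemma cochain_power2:
  assumes K: "abstract_simplicial_complex K" and f: "f \<in> cochains K i"
    and vs: "vs \<in> ordered_faces K i"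
  shows "(f vs)\<^sup>2 = (f (orientation (set vs)))\<^sup>2"
proof -
  have o: "orientation (set vs) \<in> ordered_faces K i" "set (orientation (set vs)) = set vs"
    using orientation_in[OF K] vs by (auto simp: ordered_faces_def)
  obtain p where p: "p permutes {..<length (orientation (set vs))}"
    "permute_list p (orientation (set vs)) = vs"
    using ordering_permute[of "orientation (set vs)" vs] o vs by (auto simp: ordered_faces_def)
  have "f vs = of_int (sign p) * f (orientation (set vs))"
    using f o(1) p by (force simp: cochains_def)
  then show ?thesis by (simp add: sign_def)
qed

lemma set_take_drop:
  assumes "distinct vs" "j < length vs"
  shows "set (take j vs @ drop (Suc j) vs) = set vs - {vs ! j}"
proof -
  have "distinct (take j vs @ vs ! j # drop (Suc j) vs)"
    "set vs = set (take j vs @ vs ! j # drop (Suc j) vs)"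
    using assms by (simp_all flip: id_take_nth_drop)
  then show ?thesis by auto
qed

lemma delete_nth_in_ordered_faces:
  assumes K: "abstract_simplicial_complex K"
    and vs: "vs \<in> ordered_faces K (i + 1)" and j: "j < length vs"
  shows "take j vs @ drop (Suc j) vs \<in> ordered_faces K i"
proof -
  have d: "distinct vs" "set vs \<in> K" "face_dim (set vs) = i + 1"
    using vs by (auto simp: ordered_faces_def faces_def)
  have "distinct (take j vs @ vs ! j # drop (Suc j) vs)"
    using d(1) j by (simp flip: id_take_nth_drop)
  then have "distinct (take j vs @ drop (Suc j) vs)" by auto
  moreover have "set vs - {vs ! j} \<in> K"
    using K d(2) by (auto simp: abstract_simplicial_complex_def)
  moreover have "face_dim (set vs - {vs ! j}) = i"
    using d j card_Suc_Diff1[of "set vs" "vs ! j"] by (simp add: face_dim_def)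
  ultimately show ?thesis
    using set_take_drop[OF d(1) j] by (simp add: ordered_faces_def faces_def)
qed

lemma coboundary_power2_le:
  assumes K: "abstract_simplicial_complex K" and f: "f \<in> cochains K i"
    and G: "G \<in> faces K (i + 1)"
  shows "(coboundary K i f (orientation G))\<^sup>2 \<le>
    (of_int i + 2) * (\<Sum>F | F \<in> faces K i \<and> F \<subset> G. (f (orientation F))\<^sup>2)"
proof -
  define vs where "vs = orientation G"
  define d where "d j = take j vs @ drop (Suc j) vs" for j
  have vs: "vs \<in> ordered_faces K (i + 1)" "distinct vs" "set vs = G"
    using orientation_in[OF K G] by (auto simp: vs_def ordered_faces_def)
  have n: "real (length vs) = of_int i + 2"
    using G distinct_card[OF vs(2)] vs(3) by (simp add: faces_def face_dim_def)
  have d: "d j \<in> ordered_faces K i" "set (d j) = G - {vs ! j}" if "j < length vs" for j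
    using delete_nth_in_ordered_faces[OF K vs(1) that] set_take_drop[OF vs(2) that] vs(3)
    by (simp_all add: d_def)
  \<comment> \<open>Distinct positions delete distinct vertices, so the sum over positions can be
    rewritten as a sum over faces of \<open>G\<close>.\<close>
  have inj: "inj_on (\<lambda>j. set (d j)) {..<length vs}"
  proof (rule inj_onI)
    fix j k assume jk: "j \<in> {..<length vs}" "k \<in> {..<length vs}" "set (d j) = set (d k)"
    then have "G - {vs ! j} = G - {vs ! k}" "vs ! j \<in> G" "vs ! k \<in> G"
      using d vs(3) by auto
    then have "vs ! j = vs ! k" by blast
    then show "j = k" using jk vs(2) by (simp add: nth_eq_iff_index_eq)
  qed
  have "(coboundary K i f vs)\<^sup>2 = (\<Sum>j<length vs. (-1) ^ j * f (d j))\<^sup>2"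
    using vs(1) by (simp add: coboundary_def d_def)
  also have "\<dots> \<le> real (length vs) * (\<Sum>j<length vs. ((-1) ^ j * f (d j))\<^sup>2)"
    using sum_squared_le_sum_of_squares[of "\<lambda>j. (-1) ^ j * f (d j)" "{..<length vs}"]
    by (simp add: mult.commute)
  also have "(\<Sum>j<length vs. ((-1) ^ j * f (d j))\<^sup>2) =
      (\<Sum>j<length vs. (f (orientation (set (d j))))\<^sup>2)"
    by (intro sum.cong) (simp_all add: power_mult_distrib cochain_power2[OF K f d(1)]
      flip: power_even_eq)
  also have "\<dots> = (\<Sum>F\<in>(\<lambda>j. set (d j)) ` {..<length vs}. (f (orientation F))\<^sup>2)"
    by (simp add: sum.reindex[OF inj])
  \<comment> \<open>All terms are squares, so enlarging the index set cannot decrease the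
    sum.\<close>
  also have "\<dots> \<le> (\<Sum>F | F \<in> faces K i \<and> F \<subset> G. (f (orientation F))\<^sup>2)"
  proof (rule sum_mono2)
    show "(\<lambda>j. set (d j)) ` {..<length vs} \<subseteq> {F. F \<in> faces K i \<and> F \<subset> G}"
      using d vs(3) by (fastforce simp: ordered_faces_def)
  qed (use finite_faces[OF K] in auto)
  finally show ?thesis
    unfolding vs_def[symmetric] n[symmetric] by (simp add: mult_left_mono)
qed

lemma coboundary_inner_le:
  assumes K: "abstract_simplicial_complex K" and w: "weight_function K w"
    and f: "f \<in> cochains K i"
  shows "cochain_inner K w (i + 1) (coboundary K i f) (coboundary K i f) \<le>
    (of_int i + 2) * (\<Sum>F\<in>faces K i. degree K w F * (f (orientation F))\<^sup>2)"
proof -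
  have "cochain_inner K w (i + 1) (coboundary K i f) (coboundary K i f) =
      (\<Sum>G\<in>faces K (i + 1). w G * (coboundary K i f (orientation G))\<^sup>2)"
    by (simp add: cochain_inner_def power2_eq_square mult.assoc)
  also have "\<dots> \<le> (\<Sum>G\<in>faces K (i + 1). w G *
      ((of_int i + 2) * (\<Sum>F | F \<in> faces K i \<and> F \<subset> G. (f (orientation F))\<^sup>2)))"
    using w by (intro sum_mono mult_left_mono coboundary_power2_le[OF K f])
      (auto simp: weight_function_def faces_def less_imp_le)
  also have "\<dots> = (of_int i + 2) *
      (\<Sum>G\<in>faces K (i + 1). \<Sum>F | F \<in> faces K i \<and> F \<subset> G. w G * (f (orientation F))\<^sup>2)"
    by (simp add: sum_distrib_left mult.left_commute)
  \<comment> \<open>Double counting of the incident pairs \<open>F \<subset> G\<close>: for fixed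
    \<open>F\<close>, the weights \<open>w G\<close> add up to the degree of
    \<open>F\<close>.\<close>
  also have "\<dots> = (of_int i + 2) *
      (\<Sum>F\<in>faces K i. \<Sum>G | G \<in> faces K (i + 1) \<and> F \<subset> G. w G * (f (orientation F))\<^sup>2)"
    by (subst sum.swap_restrict[OF finite_faces[OF K] finite_faces[OF K]]) (rule refl)
  also have "\<dots> = (of_int i + 2) * (\<Sum>F\<in>faces K i. degree K w F * (f (orientation F))\<^sup>2)"
    by (simp add: degree_def faces_def sum_distrib_right)
  finally show ?thesis .
qed

text \<open>A cochain is determined by its values on the chosen orientations, so a nonzero one has a
  positive term at some face. This permits division by \<open>(f, f)\<close> in the Rayleigh
  quotient.\<close>

lemma cochain_inner_pos:
  assumes K: "abstract_simplicial_complex K" and w: "weight_function K w"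
    and f: "f \<in> cochains K i" "f \<noteq> (\<lambda>_. 0)"
  shows "0 < cochain_inner K w i f f"
proof -
  have "(\<lambda>_. 0) \<in> cochains K i" by (simp add: cochains_def)
  then obtain F where F: "F \<in> faces K i" "f (orientation F) \<noteq> 0"
    using cochain_eqI[OF K f(1), of "\<lambda>_. 0"] f(2) by auto
  have pos: "0 < w G" if "G \<in> faces K i" for G
    using w that by (auto simp: weight_function_def faces_def)
  have "0 < w F * f (orientation F) * f (orientation F)"
    using pos[OF F(1)] F(2) by (auto simp: zero_less_mult_iff mult_less_0_iff linorder_neq_iff)
  then show ?thesis
    unfolding cochain_inner_def using pos finite_faces[OF K] F(1)
    by (intro sum_pos2[of _ F]) (auto simp: mult.assoc less_imp_le)
qed

text \<open>Pairing the eigenvalue equation with \<open>f\<close> and moving the adjoint across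
  gives \<open>c (f, f) = (\<delta> f, \<delta> f)\<close>. The three bounds differ only in the
  choice of \<open>M\<close>.\<close>

lemma up_laplacian_spectrum_le:
  assumes K: "abstract_simplicial_complex K" and w: "weight_function K w" and i: "0 \<le> i"
    and c: "c \<in> spectrum_on (cochains K i) (up_laplacian K w i)"
    and M: "\<And>F. F \<in> faces K i \<Longrightarrow> degree K w F \<le> M * w F"
  shows "c \<le> (of_int i + 2) * M"
proof -
  obtain f where f: "f \<in> cochains K i" "f \<noteq> (\<lambda>_. 0)" "up_laplacian K w i f = (\<lambda>x. c * f x)"
    using c by (auto simp: spectrum_on_def)
  have "c * cochain_inner K w i f f = cochain_inner K w i f (up_laplacian K w i f)"
    unfolding f(3) by (simp add: cochain_inner_def sum_distrib_left mult_ac)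
  also have "\<dots> = cochain_inner K w (i + 1) (coboundary K i f) (coboundary K i f)"
    unfolding up_laplacian_def using coboundary_adjoint(2)[OF K w f(1)] by simp
  also have "\<dots> \<le> (of_int i + 2) * (\<Sum>F\<in>faces K i. degree K w F * (f (orientation F))\<^sup>2)"
    by (rule coboundary_inner_le[OF K w f(1)])
  also have "\<dots> \<le> (of_int i + 2) * (\<Sum>F\<in>faces K i. M * w F * (f (orientation F))\<^sup>2)"
    using i M by (intro mult_left_mono sum_mono mult_right_mono) auto
  also have "\<dots> = (of_int i + 2) * M * cochain_inner K w i f f"
    by (simp add: cochain_inner_def sum_distrib_left power2_eq_square mult_ac)
  finally show ?thesis
    using cochain_inner_pos[OF K w f(1,2)] by simp
qed

text \<open>This is the case \<open>M = 1\<close>: equality holds off the facets by construction,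
  while a facet has degree 0, having no proper superface, and weight 1.\<close>

lemma degree_normalized_weight_le:
  assumes K: "abstract_simplicial_complex K" and F: "F \<in> K"
  shows "degree K (normalized_weight K) F \<le> normalized_weight K F"
proof (cases "facet K F")
  case True
  then have "{G. G \<in> faces K (face_dim F + 1) \<and> F \<subset> G} = {}"
    by (auto simp: facet_def faces_def)
  then have "degree K (normalized_weight K) F = 0" by (simp only: degree_def sum.empty)
  then show ?thesis using True by (simp add: normalized_weight_eq[OF K F])
qed (simp add: normalized_weight_eq[OF K F])

theorem theorem3p2:
  fixes K :: "'a set set" and w :: "'a set \<Rightarrow> real" and i :: int
  assumes "abstract_simplicial_complex K"
    and "weight_function K w"
    and "0 \<le> i" and "i \<le> complex_dim K"
  shows
    "((\<forall>f\<in>cochains K i. up_laplacian K w i f = normalized_up_laplacian K i f) \<longrightarrow>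
        (\<forall>c\<in>spectrum_on (cochains K i) (up_laplacian K w i). c \<le> of_int i + 2)) \<and>
     ((\<forall>F\<in>K. w F = 1) \<longrightarrow>
        (\<forall>c\<in>spectrum_on (cochains K i) (up_laplacian K w i).
           c \<le> (of_int i + 2) * (MAX F\<in>faces K i. degree K w F))) \<and>
     (\<forall>c\<in>spectrum_on (cochains K i) (up_laplacian K w i).
        c \<le> (of_int i + 2) * ((MAX F\<in>faces K i. degree K w F) / (MIN F\<in>faces K i. w F)))"
proof (intro conjI impI ballI)
  note K = assms(1) and w = assms(2) and i = assms(3)
  note fin = finite_faces[OF K, of i]
  have max: "degree K w F \<le> (MAX F\<in>faces K i. degree K w F)" if "F \<in> faces K i" for F
    using fin that by simp
  fix c assume c: "c \<in> spectrum_on (cochains K i) (up_laplacian K w i)"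
  show "c \<le> of_int i + 2"
    if "\<forall>f\<in>cochains K i. up_laplacian K w i f = normalized_up_laplacian K i f"
  proof -
    \<comment> \<open>The assumption identifies the operators on cochains, not the weights. Since
      eigenvectors are cochains, \<open>c\<close> is also an eigenvalue for
      \<open>normalized_weight\<close>, to which the bound is applied.\<close>
    have "c \<in> spectrum_on (cochains K i) (up_laplacian K (normalized_weight K) i)"
      using c that by (auto simp: spectrum_on_def normalized_up_laplacian_def)
    from up_laplacian_spectrum_le[OF K weight_function_normalized_weight[OF K] i this, of 1]
    show ?thesis using degree_normalized_weight_le[OF K] by (simp add: faces_def)
  qed
  show "c \<le> (of_int i + 2) * (MAX F\<in>faces K i. degree K w F)" if "\<forall>F\<in>K. w F = 1"
    using max that by (intro up_laplacian_spectrum_le[OF K w i c]) (simp add: faces_def)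
  show "c \<le> (of_int i + 2) * ((MAX F\<in>faces K i. degree K w F) / (MIN F\<in>faces K i. w F))"
    (is "_ \<le> _ * (?D / ?m)")
  proof (rule up_laplacian_spectrum_le[OF K w i c])
    fix F assume F: "F \<in> faces K i"
    \<comment> \<open>The minimum is attained at some face, hence positive. With
      \<open>M = ?D / ?m\<close>, the claim follows from \<open>1 \<le> w F / ?m\<close> and
      \<open>0 \<le> ?D\<close>.\<close>
    have "?m \<in> w ` faces K i" using fin F by (intro Min_in) auto
    then have "0 < ?m" using w by (auto simp: weight_function_def faces_def)
    moreover have "?m \<le> w F" using fin F by simp
    moreover have "0 \<le> ?D" using degree_nonneg[OF w, of F] max[OF F] by linarith
    ultimately have "?D * 1 \<le> ?D * (w F / ?m)" by (intro mult_left_mono) simp_all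
    then show "degree K w F \<le> ?D / ?m * w F" using max[OF F] by simp
  qed
qed

end
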